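(* Among all trees on at least two vertices, only the paths $P_2$ and $P_4$ (on two and four vertices, respectively) are $\mathrm{SRSI}$; that is, a tree $T$ on at least two vertices is $\mathrm{SRSI}$ if and only if $T$ is isomorphic to $P_2$ or $P_4$.
   Context: All graphs are simple. A weight function on a graph $G=(V,E)$ is a function $w:E\to\mathbb{R}^+$ to the positive reals. A $k$-matching is a set of $k$ pairwise disjoint edges. For a weighted graph on $n$ vertices, the weighted matching polynomial is $$m_w(G,x)=\sum_{k=0}^{\lfloor n/2\rfloor}(-1)^k\mu_w(G,k)\,x^{n-2k},\qquad \mu_w(G,k)=\sum_{M\text{ a }k\text{-matching of }G}\ \prod_{e\in M}w(e),$$ with $\mu_w(G,0)=1$. On subgraphs, $w$ is understood to be restricted. $G\setminus\{v\}$ denotes the graph obtained by deleting the vertex $v$. All roots of $m_w(G,x)$ are real. A weighted graph $G=(V,E,w)$ on $n\ge 2$ vertices is $\mathrm{SRSI}_w(v)$, where $v\in V$, if: (1) $m_w(G,x)$ has simple roots $\lambda_1<\dots<\lambda_n$; and (2) $m_w(G\setminus\{v\},x)$ has simple roots $\mu_1<\dots<\mu_{n-1}$ that strictly interlace those of $m_w(G,x)$, i.e. $\lambda_1<\mu_1<\lambda_2<\dots<\mu_{n-1}<\lambda_n$. A graph $G$ on at least two vertices is $\mathrm{SRSI}$ if it is $\mathrm{SRSI}_w(v)$ for every vertex $v$ of $G$ and every weight function $w$. *)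

theory Defs
  imports "HOL-Computational_Algebra.Polynomial" "HOL-Library.Disjoint_Sets"
begin

text \<open>A graph is given by its vertex set \<open>V\<close> and its set \<open>E\<close> of edges, each edge being a
  two-element set of vertices.\<close>

definition simple_graph :: "'a set \<Rightarrow> 'a set set \<Rightarrow> bool" where
  "simple_graph V E \<longleftrightarrow> finite V \<and> (\<forall>e\<in>E. e \<subseteq> V \<and> card e = 2)"

definition graph_connected :: "'a set \<Rightarrow> 'a set set \<Rightarrow> bool" where
  "graph_connected V E \<longleftrightarrow> V \<noteq> {} \<and> (\<forall>u\<in>V. \<forall>v\<in>V. (u, v) \<in> {(x, y). {x, y} \<in> E}\<^sup>*)"

text \<open>A cycle is the list of its vertices, without repeating the first one at the end.\<close>

definition is_cycle :: "'a set set \<Rightarrow> 'a list \<Rightarrow> bool" where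
  "is_cycle E c \<longleftrightarrow> 3 \<le> length c \<and> distinct c \<and>
     (\<forall>i<length c. {c ! i, c ! (Suc i mod length c)} \<in> E)"

definition is_tree :: "'a set \<Rightarrow> 'a set set \<Rightarrow> bool" where
  "is_tree V E \<longleftrightarrow> simple_graph V E \<and> graph_connected V E \<and> \<not> (\<exists>c. is_cycle E c)"

definition graph_iso :: "'a set \<Rightarrow> 'a set set \<Rightarrow> 'b set \<Rightarrow> 'b set set \<Rightarrow> bool" where
  "graph_iso V E V' E' \<longleftrightarrow>
     (\<exists>f. bij_betw f V V' \<and> (\<forall>u\<in>V. \<forall>v\<in>V. {u, v} \<in> E \<longleftrightarrow> {f u, f v} \<in> E'))"

definition path_verts :: "nat \<Rightarrow> nat set" where
  "path_verts n = {..<n}"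

definition path_edges :: "nat \<Rightarrow> nat set set" where
  "path_edges n = {{i, Suc i} | i. Suc i < n}"

definition del_vertex :: "'a set set \<Rightarrow> 'a \<Rightarrow> 'a set set" where
  "del_vertex E v = {e \<in> E. v \<notin> e}"

definition k_matchings :: "'a set set \<Rightarrow> nat \<Rightarrow> 'a set set set" where
  "k_matchings E k = {M. M \<subseteq> E \<and> finite M \<and> card M = k \<and> disjoint M}"

text \<open>Weights are total functions on sets; only their values on the edges matter, so the
  restriction of a weight function to a subgraph needs no notation.\<close>

definition weight_function :: "'a set set \<Rightarrow> ('a set \<Rightarrow> real) \<Rightarrow> bool" where
  "weight_function E w \<longleftrightarrow> (\<forall>e\<in>E. 0 < w e)"

definition matching_weight :: "'a set set \<Rightarrow> ('a set \<Rightarrow> real) \<Rightarrow> nat \<Rightarrow> real" where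
  "matching_weight E w k = (\<Sum>M\<in>k_matchings E k. \<Prod>e\<in>M. w e)"

definition matching_poly :: "'a set \<Rightarrow> 'a set set \<Rightarrow> ('a set \<Rightarrow> real) \<Rightarrow> real poly" where
  "matching_poly V E w =
     (\<Sum>k = 0..card V div 2. monom ((-1) ^ k * matching_weight E w k) (card V - 2 * k))"

text \<open>\<open>r 1 < \<dots> < r k\<close> are all the real roots of \<open>p\<close>, and each of them is simple. Matching
  polynomials have only real roots, so nothing is lost by not mentioning complex ones.\<close>

definition simple_roots :: "real poly \<Rightarrow> nat \<Rightarrow> (nat \<Rightarrow> real) \<Rightarrow> bool" where
  "simple_roots p k r \<longleftrightarrow> strict_mono_on {1..k} r \<and> {x. poly p x = 0} = r ` {1..k} \<and>
     (\<forall>i\<in>{1..k}. order (r i) p = 1)"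

definition SRSI_at :: "'a set \<Rightarrow> 'a set set \<Rightarrow> ('a set \<Rightarrow> real) \<Rightarrow> 'a \<Rightarrow> bool" where
  "SRSI_at V E w v \<longleftrightarrow> 2 \<le> card V \<and> v \<in> V \<and>
     (\<exists>lam mu. simple_roots (matching_poly V E w) (card V) lam \<and>
        simple_roots (matching_poly (V - {v}) (del_vertex E v) w) (card V - 1) mu \<and>
        (\<forall>i\<in>{1..card V - 1}. lam i < mu i \<and> mu i < lam (Suc i)))"

definition SRSI :: "'a set \<Rightarrow> 'a set set \<Rightarrow> bool" where
  "SRSI V E \<longleftrightarrow> 2 \<le> card V \<and> (\<forall>v\<in>V. \<forall>w. weight_function E w \<longrightarrow> SRSI_at V E w v)"

end

theory Submission
  imports Defs
begin

text \<open>
  If a tree contains a path on five vertices with middle vertex \<open>v\<close>, then deleting \<open>v\<close> leaves at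
  least two components with an edge. Multiplying the weights in one of them by a constant \<open>t\<^sup>2\<close>
  multiplies the roots of its factor of the matching polynomial by \<open>t\<close>, so some nonzero root can be
  made to coincide with a nonzero root of the other factor; the roots are then no longer simple.

  The remaining trees are excluded by looking at the root \<open>0\<close>. If the number of vertices is even,
  \<open>0\<close> would be a multiple root, so there is a perfect matching and no two leaves share a neighbour.
  If it is odd, \<open>0\<close> is a root, so by strict interlacing every vertex-deleted subgraph has a perfect
  matching, which fails for the neighbour of a leaf.
\<close>

subsection \<open>Matching polynomials\<close>

text \<open>Collects matchings of every size, so that the matching polynomial becomes a single sum
  that can be reindexed without tracking the size \<open>k\<close>.\<close>

definition matchings :: "'a set set \<Rightarrow> 'a set set set" where
  "matchings E = {M. M \<subseteq> E \<and> disjoint M}"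

section \<open>Simple roots, simple graphs and sizes of matchings\<close>

lemma simple_roots_order:
  assumes "simple_roots p k r" "poly p x = 0"
  shows "order x p = 1"
proof -
  have "x \<in> r ` {1..k}" using assms by (auto simp: simple_roots_def)
  thus ?thesis using assms(1) by (auto simp: simple_roots_def)
qed

lemma simple_roots_card: "simple_roots p k r \<Longrightarrow> card {x. poly p x = 0} = k"
  unfolding simple_roots_def by (simp add: card_image strict_mono_on_imp_inj_on)

lemma simple_graph_edge_other_end:
  assumes "simple_graph V E" "e \<in> E" "a \<in> e"
  obtains x where "e = {a, x}"
proof -
  have "card e = 2" using assms by (simp add: simple_graph_def)
  then obtain y z where "e = {y, z}" by (auto simp: card_2_iff)
  hence "e = {a, y} \<or> e = {a, z}" using assms(3) by auto
  thus thesis using that by blast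
qed

lemma simple_graph_finite_edges: "simple_graph V E \<Longrightarrow> finite E"
  unfolding simple_graph_def by (meson Pow_iff finite_Pow_iff finite_subset subsetI)

lemma finite_matchings: "finite E \<Longrightarrow> finite (matchings E)"
  unfolding matchings_def by (rule finite_subset[of _ "Pow E"]) auto

lemma k_matchings_eq: "finite E \<Longrightarrow> k_matchings E k = {M \<in> matchings E. card M = k}"
  unfolding k_matchings_def matchings_def by (auto intro: finite_subset)

lemma card_Union_matching:
  assumes "simple_graph V E" "M \<in> matchings E"
  shows "card (\<Union>M) = 2 * card M"
proof -
  have "card (\<Union>M) = sum card M"
    using assms by (intro card_Union_disjoint)
      (auto simp: matchings_def simple_graph_def disjoint_def intro: finite_subset)
  also have "\<dots> = (\<Sum>e\<in>M. 2)"
    using assms by (intro sum.cong) (auto simp: matchings_def simple_graph_def)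
  finally show ?thesis by simp
qed

lemma Union_matching_subset:
  "simple_graph V E \<Longrightarrow> M \<in> matchings E \<Longrightarrow> \<Union>M \<subseteq> V"
  by (auto simp: matchings_def simple_graph_def)

lemma card_matching_le:
  assumes "simple_graph V E" "M \<in> matchings E"
  shows "2 * card M \<le> card V"
  using card_mono[OF _ Union_matching_subset[OF assms]] card_Union_matching[OF assms] assms(1)
  by (simp add: simple_graph_def)

text \<open>The sign (-1)^k is absorbed by giving each edge the factor \<open>- w e\<close>, and the
  double sum over \<open>k\<close> and the \<open>k\<close>-matchings is merged into one by grouping
  matchings by size.\<close>

lemma poly_matching_poly:
  assumes "simple_graph V E"
  shows "poly (matching_poly V E w) x =
    (\<Sum>M\<in>matchings E. (\<Prod>e\<in>M. - w e) * x ^ (card V - 2 * card M))"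
proof -
  note fin = simple_graph_finite_edges[OF assms]
  have "poly (matching_poly V E w) x = (\<Sum>k = 0..card V div 2. \<Sum>M\<in>{M \<in> matchings E. card M = k}.
      (- 1) ^ k * prod w M * x ^ (card V - 2 * k))"
    unfolding matching_poly_def poly_sum poly_monom matching_weight_def k_matchings_eq[OF fin]
    by (simp only: sum_distrib_left sum_distrib_right)
  also have "\<dots> = (\<Sum>k = 0..card V div 2. \<Sum>M\<in>{M \<in> matchings E. card M = k}.
      (\<Prod>e\<in>M. - w e) * x ^ (card V - 2 * card M))"
    by (intro sum.cong refl) (simp add: prod_uminus)
  also have "\<dots> = (\<Sum>M\<in>matchings E. (\<Prod>e\<in>M. - w e) * x ^ (card V - 2 * card M))"
    using card_matching_le[OF assms] by (intro sum.group finite_matchings fin) fastforce+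
  finally show ?thesis .
qed

lemma degree_matching_poly_le: "degree (matching_poly V E w) \<le> card V"
  unfolding matching_poly_def
  by (intro degree_sum_le) (auto intro: order.trans[OF degree_monom_le])

text \<open>Only the empty matching contributes to the top power, since the exponent drops by two
  with every edge. Being monic, the polynomial is nonzero and has at most \<open>card V\<close>
  roots.\<close>

lemma coeff_matching_poly_card:
  assumes "simple_graph V E"
  shows "coeff (matching_poly V E w) (card V) = 1"
proof -
  have "k_matchings E 0 = {{}}" by (auto simp: k_matchings_def)
  hence "matching_weight E w 0 = 1" by (simp add: matching_weight_def)
  moreover have "coeff (matching_poly V E w) (card V) =
      (\<Sum>k = 0..card V div 2. if k = 0 then matching_weight E w 0 else 0)"
    unfolding matching_poly_def coeff_sum by (intro sum.cong) auto
  ultimately show ?thesis by simp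
qed

lemma matching_poly_nonzero: "simple_graph V E \<Longrightarrow> matching_poly V E w \<noteq> 0"
  using coeff_matching_poly_card[of V E w] by auto

lemma card_roots_matching_poly_le:
  assumes "simple_graph V E"
  shows "card {x. poly (matching_poly V E w) x = 0} \<le> card V"
  using card_poly_roots_bound[OF matching_poly_nonzero[OF assms]] degree_matching_poly_le
  by (rule order.trans)

text \<open>Makes it possible to change the weights in one component and leave the polynomial of
  another one alone.\<close>

lemma matching_poly_cong:
  assumes "\<And>e. e \<in> E \<Longrightarrow> w e = w' e"
  shows "matching_poly V E w = matching_poly V E w'"
proof -
  have "matching_weight E w = matching_weight E w'"
    unfolding matching_weight_def k_matchings_def
    by (intro ext sum.cong prod.cong refl assms) auto
  thus ?thesis by (simp add: matching_poly_def)
qed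

text \<open>With n vertices, a matching with k edges gains t^(2k) from the weights and t^(n-2k) from
  the power of the argument, so every term gains the same factor t^n. Hence scaling the weights by
  t^2 carries a root x to the root t x.\<close>

lemma poly_matching_poly_scale:
  assumes "simple_graph V E"
  shows "poly (matching_poly V E (\<lambda>e. t\<^sup>2 * w e)) (t * x) = t ^ card V * poly (matching_poly V E w) x"
proof -
  have "(\<Prod>e\<in>M. - (t\<^sup>2 * w e)) * (t * x) ^ (card V - 2 * card M) =
      t ^ card V * ((\<Prod>e\<in>M. - w e) * x ^ (card V - 2 * card M))" if "M \<in> matchings E" for M
  proof -
    have "t ^ card V = t ^ (2 * card M) * t ^ (card V - 2 * card M)"
      using card_matching_le[OF assms that] by (simp flip: power_add)
    moreover have "(\<Prod>e\<in>M. - (t\<^sup>2 * w e)) = t ^ (2 * card M) * (\<Prod>e\<in>M. - w e)"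
      by (simp add: prod.distrib power_mult flip: mult_minus_right)
    ultimately show ?thesis by (simp add: power_mult_distrib)
  qed
  thus ?thesis
    by (simp add: poly_matching_poly[OF assms] sum_distrib_left)
qed

text \<open>Edges of different parts never meet, so a matching of the union is the same as a pair of
  matchings \<open>(M \<inter> EA, M \<inter> EB)\<close>; weights multiply and exponents
  add.\<close>

lemma matching_poly_disjoint_union:
  assumes A: "simple_graph A EA" and B: "simple_graph B EB" and AB: "A \<inter> B = {}"
  shows "matching_poly (A \<union> B) (EA \<union> EB) w = matching_poly A EA w * matching_poly B EB w"
proof -
  have fin: "finite EA" "finite EB" using A B simple_graph_finite_edges by auto
  have cross: "e \<inter> e' = {}" if "e \<in> EA" "e' \<in> EB" for e e'
    using A B AB that unfolding simple_graph_def by blast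
  have "{} \<notin> EA" using A by (auto simp: simple_graph_def)
  \<comment> \<open>By \<open>cross\<close>, a common edge would be disjoint from itself, hence
    empty.\<close>
  hence EAB: "EA \<inter> EB = {}" using cross by (metis Int_absorb disjoint_iff)
  have U: "simple_graph (A \<union> B) (EA \<union> EB)"
    using A B unfolding simple_graph_def by blast
  have cardAB: "card (A \<union> B) = card A + card B"
    using A B AB by (simp add: card_Un_disjoint simple_graph_def)
  have "poly (matching_poly (A \<union> B) (EA \<union> EB) w) x =
      poly (matching_poly A EA w * matching_poly B EB w) x" for x
  proof -
    let ?h = "\<lambda>n M. (\<Prod>e\<in>M. - w e) * x ^ (n - 2 * card M)"
    have "(\<Sum>M\<in>matchings (EA \<union> EB). ?h (card (A \<union> B)) M) =
        (\<Sum>(M, N)\<in>matchings EA \<times> matchings EB. ?h (card A) M * ?h (card B) N)"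
    proof (rule sum.reindex_bij_witness[where i = "\<lambda>(M, N). M \<union> N" and j = "\<lambda>M. (M \<inter> EA, M \<inter> EB)"])
      fix M assume M: "M \<in> matchings (EA \<union> EB)"
      show "(case (M \<inter> EA, M \<inter> EB) of (M, N) \<Rightarrow> M \<union> N) = M"
        using M by (auto simp: matchings_def)
      show "(M \<inter> EA, M \<inter> EB) \<in> matchings EA \<times> matchings EB"
        using M by (auto simp: matchings_def disjoint_def)
    next
      fix p assume p: "p \<in> matchings EA \<times> matchings EB"
      then obtain M N where MN: "p = (M, N)" "M \<in> matchings EA" "N \<in> matchings EB" by blast
      show "((case p of (M, N) \<Rightarrow> M \<union> N) \<inter> EA, (case p of (M, N) \<Rightarrow> M \<union> N) \<inter> EB) = p"
        using MN EAB by (auto simp: matchings_def)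
      show "(case p of (M, N) \<Rightarrow> M \<union> N) \<in> matchings (EA \<union> EB)"
      proof -
        have "e \<inter> e' = {}" if "e \<in> M \<union> N" "e' \<in> M \<union> N" "e \<noteq> e'" for e e'
          using MN(2,3) that cross[of e e'] cross[of e' e] unfolding matchings_def disjoint_def
          by (elim UnE) (simp_all add: subset_iff Int_commute)
        thus ?thesis using MN by (auto simp: matchings_def disjoint_def)
      qed
    next
      fix M assume M: "M \<in> matchings (EA \<union> EB)"
      define K L where "K = M \<inter> EA" and "L = M \<inter> EB"
      have KL: "K \<in> matchings EA" "L \<in> matchings EB" "M = K \<union> L" "K \<inter> L = {}"
        using M EAB by (auto simp: K_def L_def matchings_def disjoint_def)
      have f: "finite K" "finite L" using fin by (auto simp: K_def L_def)
      have c: "card M = card K + card L" using KL f by (simp add: card_Un_disjoint)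
      have "card (A \<union> B) - 2 * card M = (card A - 2 * card K) + (card B - 2 * card L)"
        using card_matching_le[OF A KL(1)] card_matching_le[OF B KL(2)] c cardAB by simp
      moreover have "(\<Prod>e\<in>M. - w e) = (\<Prod>e\<in>K. - w e) * (\<Prod>e\<in>L. - w e)"
        unfolding KL(3) using f KL(4) by (rule prod.union_disjoint)
      ultimately show "(case (M \<inter> EA, M \<inter> EB) of (M, N) \<Rightarrow> ?h (card A) M * ?h (card B) N) = ?h (card (A \<union> B)) M"
        by (simp add: power_add flip: K_def L_def)
    qed
    thus ?thesis
      by (simp add: poly_matching_poly A B U sum_product sum.cartesian_product)
  qed
  thus ?thesis by (simp flip: poly_eq_poly_eq_iff add: fun_eq_iff)
qed

section \<open>The value at zero and perfect matchings\<close>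

lemma perfect_matching_of_poly_0:
  assumes "simple_graph V E" "poly (matching_poly V E w) 0 \<noteq> 0"
  shows "\<exists>M\<in>matchings E. \<Union>M = V"
proof -
  obtain M where M: "M \<in> matchings E" "(0::real) ^ (card V - 2 * card M) \<noteq> 0"
    using assms(2) unfolding poly_matching_poly[OF assms(1)]
    by (metis (no_types, lifting) mult_zero_right sum.neutral)
  \<comment> \<open>A power of 0 is nonzero only for exponent 0, which under truncated subtraction
    says \<open>card V \<le> 2 * card M\<close>.\<close>
  hence "card V \<le> card (\<Union>M)"
    using card_Union_matching[OF assms(1) M(1)] by (auto simp: power_0_left split: if_splits)
  thus ?thesis
    using M(1) Union_matching_subset[OF assms(1) M(1)] assms(1)
    by (metis card_seteq simple_graph_def)
qed

lemma poly_matching_poly_0_odd: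
  assumes "simple_graph V E" "odd (card V)"
  shows "poly (matching_poly V E w) 0 = 0"
  unfolding poly_matching_poly[OF assms(1)]
proof (intro sum.neutral ballI)
  fix M assume "M \<in> matchings E"
  hence "2 * card M \<le> card V" by (rule card_matching_le[OF assms(1)])
  moreover have "2 * card M \<noteq> card V" using assms(2) by (metis dvd_triv_left)
  ultimately show "(\<Prod>e\<in>M. - w e) * 0 ^ (card V - 2 * card M) = 0" by simp
qed

lemma simple_graph_del_vertex: "simple_graph V E \<Longrightarrow> simple_graph (V - {v}) (del_vertex E v)"
  by (auto simp: simple_graph_def del_vertex_def)

text \<open>For an even number of vertices only even powers occur, so a root at 0 would be at least
  double. Unit weights are enough to exploit this.\<close>

lemma SRSI_even_perfect_matching:
  assumes G: "simple_graph V E" and S: "SRSI V E" and ev: "even (card V)"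
  shows "\<exists>M\<in>matchings E. \<Union>M = V"
proof -
  define p where "p = matching_poly V E (\<lambda>_. 1)"
  have "V \<noteq> {}" using S by (auto simp: SRSI_def)
  then obtain v where "v \<in> V" by blast
  hence "SRSI_at V E (\<lambda>_. 1) v" using S by (auto simp: SRSI_def weight_function_def)
  then obtain r where r: "simple_roots p (card V) r" by (auto simp: SRSI_at_def p_def)
  have "poly p 0 \<noteq> 0"
  proof
    assume 0: "poly p 0 = 0"
    hence "order 0 p = 1" by (rule simple_roots_order[OF r])
    moreover have "coeff p 1 = 0"
      unfolding p_def matching_poly_def coeff_sum using ev
      by (intro sum.neutral) (auto elim!: evenE, presburger?)
    \<comment> \<open>The constant coefficient vanishes with the value at 0 and the linear one by
      parity, so the order of 0 is at least 2.\<close>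
    hence "monom 1 2 dvd p"
      unfolding monom_1_dvd_iff' using 0 by (auto simp: less_2_cases_iff poly_0_coeff_0)
    ultimately show False
      using monom_1_dvd_iff[of p 2] matching_poly_nonzero[OF G] by (simp add: p_def)
  qed
  thus ?thesis using perfect_matching_of_poly_0[OF G] by (simp add: p_def)
qed

text \<open>For an odd number of vertices 0 is a root. Strict interlacing forbids common roots, so
  the polynomial of the vertex-deleted graph does not vanish at 0.\<close>

lemma SRSI_odd_perfect_matching:
  assumes G: "simple_graph V E" and S: "SRSI V E" and odd: "odd (card V)" and v: "v \<in> V"
  shows "\<exists>M\<in>matchings (del_vertex E v). \<Union>M = V - {v}"
proof -
  have "SRSI_at V E (\<lambda>_. 1) v" using S v by (auto simp: SRSI_def weight_function_def)
  then obtain r s where r: "simple_roots (matching_poly V E (\<lambda>_. 1)) (card V) r"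
    and s: "simple_roots (matching_poly (V - {v}) (del_vertex E v) (\<lambda>_. 1)) (card V - 1) s"
    and rs: "\<And>i. i \<in> {1..card V - 1} \<Longrightarrow> r i < s i \<and> s i < r (Suc i)"
    by (auto simp: SRSI_at_def)
  have mono: "strict_mono_on {1..card V} r" using r by (simp add: simple_roots_def)
  \<comment> \<open>Either \<open>i \<le> j\<close> and \<open>r i \<le> r j < s j\<close>, or
    \<open>j < i\<close> and \<open>s j < r (Suc j) \<le> r i\<close>.\<close>
  have ne: "r i \<noteq> s j" if "i \<in> {1..card V}" "j \<in> {1..card V - 1}" for i j
  proof (cases "i \<le> j")
    case True
    hence "r i \<le> r j" using mono that
      by (intro strict_mono_on_leD[OF mono]) auto
    thus ?thesis using rs[OF that(2)] by simp
  next
    case False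
    hence "r (Suc j) \<le> r i" using mono that
      by (intro strict_mono_on_leD[OF mono]) auto
    thus ?thesis using rs[OF that(2)] by simp
  qed
  have "0 \<in> r ` {1..card V}"
    using poly_matching_poly_0_odd[OF G odd, of "\<lambda>_. 1"] r by (auto simp: simple_roots_def)
  hence "0 \<notin> s ` {1..card V - 1}" using ne by (metis imageE)
  hence "poly (matching_poly (V - {v}) (del_vertex E v) (\<lambda>_. 1)) 0 \<noteq> 0"
    using s by (auto simp: simple_roots_def)
  thus ?thesis by (rule perfect_matching_of_poly_0[OF simple_graph_del_vertex[OF G]])
qed

subsection \<open>Trees with strict root interlacing\<close>

lemma is_cycleI:
  assumes "successively (\<lambda>x y. {x, y} \<in> E) c" "distinct c" "3 \<le> length c" "{last c, hd c} \<in> E"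
  shows "is_cycle E c"
proof -
  have "{c ! i, c ! (Suc i mod length c)} \<in> E" if "i < length c" for i
  proof (cases "Suc i < length c")
    case True
    thus ?thesis using assms(1) by (simp add: successively_conv_nth)
  next
    case False
    hence "Suc i = length c" using that by simp
    moreover have "c \<noteq> []" using assms(3) by auto
    ultimately show ?thesis
      using assms(4) by (metis last_conv_nth hd_conv_nth mod_self diff_Suc_1)
  qed
  thus ?thesis using assms by (simp add: is_cycle_def)
qed

text \<open>Loop erasure: whenever the walk returns to a vertex of the path built so far, the path
  is cut off right after that vertex.\<close>

lemma rtrancl_imp_simple_path:
  assumes "(x, y) \<in> {(x, y). {x, y} \<in> E}\<^sup>*"
  shows "\<exists>p. p \<noteq> [] \<and> hd p = x \<and> last p = y \<and> distinct p \<and> successively (\<lambda>x y. {x, y} \<in> E) p"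
  using assms
proof (induction rule: rtrancl_induct)
  case base
  show ?case by (rule exI[of _ "[x]"]) simp
next
  case (step y z)
  then obtain p where p: "p \<noteq> []" "hd p = x" "last p = y" "distinct p"
    "successively (\<lambda>x y. {x, y} \<in> E) p" by blast
  show ?case
  proof (cases "z \<in> set p")
    case True
    then obtain q r where "p = q @ z # r" by (auto simp: in_set_conv_decomp)
    hence "p = (q @ [z]) @ r" by simp
    thus ?thesis using p
      by (intro exI[of _ "q @ [z]"]) (auto simp: hd_append successively_append_iff split: if_splits)
  next
    case False
    thus ?thesis using p step.hyps
      by (intro exI[of _ "p @ [z]"]) (auto simp: successively_append_iff)
  qed
qed

text \<open>A simple path from \<open>u\<close> to \<open>u'\<close> in the graph without
  \<open>v\<close> would close up through \<open>v\<close> to a cycle.\<close>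

lemma acyclic_del_vertex_separates:
  assumes ac: "\<nexists>c. is_cycle E c" and e: "{u, v} \<in> E" "{v, u'} \<in> E" and ne: "u \<noteq> u'"
  shows "(u, u') \<notin> {(x, y). {x, y} \<in> del_vertex E v}\<^sup>*"
proof
  assume "(u, u') \<in> {(x, y). {x, y} \<in> del_vertex E v}\<^sup>*"
  then obtain p where p: "p \<noteq> []" "hd p = u" "last p = u'" "distinct p"
    "successively (\<lambda>x y. {x, y} \<in> del_vertex E v) p"
    using rtrancl_imp_simple_path by metis
  from p ne obtain y q where q: "p = u # y # q" by (cases p; cases "tl p") auto
  \<comment> \<open>The path has at least two vertices, so each of them lies on one of its edges,
    and those edges avoid \<open>v\<close>.\<close>
  have "v \<notin> set p"
  proof
    assume "v \<in> set p"
    then obtain i where i: "i < length p" "p ! i = v" by (auto simp: in_set_conv_nth)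
    show False
    proof (cases "Suc i < length p")
      case True
      thus False using p(5) i by (auto simp: successively_conv_nth del_vertex_def)
    next
      case False
      with i q obtain j where "i = Suc j" by (cases i) auto
      thus False using p(5) i by (auto simp: successively_conv_nth del_vertex_def)
    qed
  qed
  moreover have "successively (\<lambda>x y. {x, y} \<in> E) p"
    using p(5) by (rule successively_mono) (auto simp: del_vertex_def)
  ultimately have "is_cycle E (v # p)"
    using p e q by (intro is_cycleI) (auto simp: insert_commute)
  thus False using ac by blast
qed

text \<open>Deleting \<open>v\<close> separates \<open>b\<close> from \<open>c\<close>, so the edges
  \<open>{a, b}\<close> and \<open>{c, d}\<close> belong to different factors of the matching
  polynomial. Rescaling the weights of one factor creates a common root.\<close>

lemma SRSI_acyclic_no_path5:
  assumes G: "simple_graph V E" and ac: "\<nexists>c. is_cycle E c" and S: "SRSI V E"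
    and d: "distinct [a, b, v, c, d]"
    and e: "{a, b} \<in> E" "{b, v} \<in> E" "{v, c} \<in> E" "{c, d} \<in> E"
  shows False
proof -
  define E' where "E' = del_vertex E v"
  define R where "R = {(x, y). {x, y} \<in> E'}\<^sup>*"
  define A where "A = {x. (b, x) \<in> R}"
  \<comment> \<open>\<open>A\<close> is the component of \<open>b\<close> after deleting
    \<open>v\<close>; \<open>B\<close> gathers all the other components and need not be
    connected.\<close>
  define B where "B = V - {v} - A"
  define EA where "EA = {e \<in> E'. e \<subseteq> A}"
  define EB where "EB = {e \<in> E'. e \<subseteq> B}"
  have G': "simple_graph (V - {v}) E'" unfolding E'_def by (rule simple_graph_del_vertex[OF G])
  have V: "a \<in> V" "b \<in> V" "c \<in> V" "d \<in> V" "v \<in> V"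
    using G e unfolding simple_graph_def by blast+
  have e': "{a, b} \<in> E'" "{c, d} \<in> E'" using e d by (auto simp: E'_def del_vertex_def)
  have step: "y \<in> A" if "x \<in> A" "{x, y} \<in> E'" for x y
    using that unfolding A_def R_def by (auto intro: rtrancl_into_rtrancl)
  have bA: "b \<in> A" by (simp add: A_def R_def)
  have aA: "a \<in> A" using step[OF bA, of a] e'(1) by (simp add: insert_commute)
  have cA: "c \<notin> A"
    using acyclic_del_vertex_separates[OF ac e(2,3)] d by (simp add: A_def R_def E'_def)
  have dA: "d \<notin> A" using step[of d c] cA e'(2) by (auto simp: insert_commute)
  have AV: "A \<subseteq> V - {v}"
  proof
    fix x assume "x \<in> A"
    hence "(b, x) \<in> {(x, y). {x, y} \<in> E'}\<^sup>*" by (simp add: A_def R_def)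
    thus "x \<in> V - {v}"
      by (induction rule: rtrancl_induct) (use V d G' in \<open>auto simp: simple_graph_def\<close>)
  qed
  have fin: "finite V" using G by (simp add: simple_graph_def)
  have finA: "finite A" "finite B" using AV fin by (auto simp: B_def intro: finite_subset)
  have EAB: "E' = EA \<union> EB"
  proof -
    have "e \<subseteq> A \<or> e \<subseteq> B" if "e \<in> E'" for e
    proof -
      obtain x y where xy: "e = {x, y}" "x \<in> V - {v}" "y \<in> V - {v}"
        using G' \<open>e \<in> E'\<close> unfolding simple_graph_def by (metis card_2_iff insert_subset)
      have "x \<in> A \<longleftrightarrow> y \<in> A"
        using step[of x y] step[of y x] \<open>e \<in> E'\<close> xy(1) by (auto simp: insert_commute)
      thus ?thesis using xy by (auto simp: B_def)
    qed
    thus ?thesis by (auto simp: EA_def EB_def)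
  qed
  have GA: "simple_graph A EA" and GB: "simple_graph B EB"
    using G' finA by (auto simp: simple_graph_def EA_def EB_def)
  have VAB: "V - {v} = A \<union> B" "A \<inter> B = {}" using AV by (auto simp: B_def)
  have prod: "matching_poly (V - {v}) (del_vertex E v) w = matching_poly A EA w * matching_poly B EB w" for w
    using matching_poly_disjoint_union[OF GA GB VAB(2)] VAB(1) EAB by (simp add: E'_def)
  have simple: "\<exists>r. simple_roots (matching_poly A EA w * matching_poly B EB w) (card V - 1) r"
    if "\<And>e. 0 < w e" for w
  proof -
    have "SRSI_at V E w v" using S V(5) that by (simp add: SRSI_def weight_function_def)
    thus ?thesis unfolding SRSI_at_def prod by blast
  qed
  define p where "p = matching_poly A EA (\<lambda>_. 1)"
  define q where "q = matching_poly B EB (\<lambda>_. 1)"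
  obtain r where r: "simple_roots (p * q) (card V - 1) r"
    using simple[of "\<lambda>_. 1"] by (auto simp: p_def q_def)
  have np: "p \<noteq> 0" "q \<noteq> 0" using matching_poly_nonzero GA GB by (auto simp: p_def q_def)
  \<comment> \<open>The product has as many distinct roots as \<open>A\<close> and \<open>B\<close>
    have vertices together, and neither factor can have more roots than its part has vertices. So
    both bounds are attained, and having at least two distinct roots, each factor has a nonzero
    one.\<close>
  have "card A + card B = card V - 1"
    using VAB fin finA V(5) by (metis card_Diff_singleton card_Un_disjoint)
  also have "\<dots> = card ({x. poly p x = 0} \<union> {x. poly q x = 0})"
    using simple_roots_card[OF r] by (simp add: Collect_disj_eq)
  also have "\<dots> \<le> card {x. poly p x = 0} + card {x. poly q x = 0}" by (rule card_Un_le)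
  finally have "card A + card B \<le> card {x. poly p x = 0} + card {x. poly q x = 0}" .
  moreover have "card {x. poly p x = 0} \<le> card A" "card {x. poly q x = 0} \<le> card B"
    unfolding p_def q_def by (intro card_roots_matching_poly_le GA GB)+
  ultimately have "card A \<le> card {x. poly p x = 0}" "card B \<le> card {x. poly q x = 0}" by linarith+
  moreover have "card {a, b} \<le> card A" using aA bA finA by (intro card_mono) auto
  moreover have "card {c, d} \<le> card B"
    using cA dA V finA d by (intro card_mono) (auto simp: B_def)
  ultimately have "1 < card {x. poly p x = 0}" "1 < card {x. poly q x = 0}" using d by auto
  moreover have "\<exists>x. x \<noteq> 0 \<and> poly f x = 0" if f: "1 < card {x. poly f x = 0}" for f :: "real poly"
  proof (rule ccontr)
    assume "\<not> ?thesis"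
    hence "card {x. poly f x = 0} \<le> card {0::real}" by (intro card_mono) auto
    thus False using f by simp
  qed
  ultimately obtain \<alpha> \<beta> where ab: "\<alpha> \<noteq> 0" "poly p \<alpha> = 0" "\<beta> \<noteq> 0" "poly q \<beta> = 0" by metis
  define t where "t = \<beta> / \<alpha>"
  have t: "t \<noteq> 0" "t * \<alpha> = \<beta>" using ab by (auto simp: t_def)
  \<comment> \<open>The quotient \<open>t\<close> may be negative, but the weights use only its
    square and stay positive. The factor 1 matches the form of the scaling lemma for unit
    weights.\<close>
  define w where "w e = (if e \<in> EA then t\<^sup>2 * 1 else 1)" for e
  have EAEB: "e \<notin> EA" if "e \<in> EB" for e
  proof
    assume "e \<in> EA"
    hence "e \<subseteq> A \<inter> B" using that by (auto simp: EA_def EB_def)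
    thus False using that GB VAB(2) by (auto simp: simple_graph_def)
  qed
  have wA: "matching_poly A EA w = matching_poly A EA (\<lambda>_. t\<^sup>2 * 1)"
    by (rule matching_poly_cong) (simp add: w_def)
  have wB: "matching_poly B EB w = q"
    unfolding q_def by (rule matching_poly_cong) (simp add: w_def EAEB)
  let ?p' = "matching_poly A EA w"
  have "poly ?p' \<beta> = 0"
    using poly_matching_poly_scale[OF GA, of t "\<lambda>_. 1" \<alpha>] ab t by (simp add: wA p_def)
  moreover have n: "?p' \<noteq> 0" by (rule matching_poly_nonzero[OF GA])
  ultimately have o: "order \<beta> ?p' \<noteq> 0" "order \<beta> q \<noteq> 0"
    using np ab by (auto simp: order_root)
  have "0 < w e" for e using t(1) by (simp add: w_def)
  then obtain r' where "simple_roots (?p' * q) (card V - 1) r'"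
    using simple[of w] unfolding wB by blast
  \<comment> \<open>As a root of both factors, \<open>\<beta>\<close> has order at least 2 in the
    product.\<close>
  from simple_roots_order[OF this, of \<beta>] have "order \<beta> (?p' * q) = 1" using ab by simp
  thus False using o n np by (simp add: order_mult)
qed

section \<open>Leaves and perfect matchings\<close>

lemma SRSI_leaf_imp_even:
  assumes G: "simple_graph V E" and S: "SRSI V E" and ab: "{a, b} \<in> E"
    and leaf: "\<And>x. {a, x} \<in> E \<Longrightarrow> x = b"
  shows "even (card V)"
proof (rule ccontr)
  assume odd: "odd (card V)"
  have V: "a \<in> V" "b \<in> V" "a \<noteq> b" using G ab by (auto simp: simple_graph_def)
  obtain M where M: "M \<in> matchings (del_vertex E b)" "\<Union>M = V - {b}"
    using SRSI_odd_perfect_matching[OF G S odd V(2)] by blast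
  \<comment> \<open>Deleting \<open>b\<close> isolates the leaf \<open>a\<close>, yet the perfect
    matching has to cover it.\<close>
  then obtain e where e: "e \<in> M" "a \<in> e" using V by blast
  have "e \<in> E" "b \<notin> e" using M e by (auto simp: matchings_def del_vertex_def)
  obtain x where x: "e = {a, x}" by (rule simple_graph_edge_other_end[OF G \<open>e \<in> E\<close> e(2)])
  have "x = b" by (rule leaf) (use \<open>e \<in> E\<close> x in simp)
  thus False using x \<open>b \<notin> e\<close> by simp
qed

text \<open>A perfect matching can cover a leaf only by its single edge. The edges of two leaves at
  \<open>b\<close> would both lie in the matching and meet in \<open>b\<close>.\<close>

lemma SRSI_leaf_unique:
  assumes G: "simple_graph V E" and S: "SRSI V E" and ab: "{a, b} \<in> E" "{a', b} \<in> E"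
    and leaf: "\<And>x. {a, x} \<in> E \<Longrightarrow> x = b" and leaf': "\<And>x. {a', x} \<in> E \<Longrightarrow> x = b"
  shows "a = a'"
proof -
  have V: "a \<in> V" "a' \<in> V" "a \<noteq> b" "a' \<noteq> b" using G ab by (auto simp: simple_graph_def)
  have "even (card V)" by (rule SRSI_leaf_imp_even[OF G S ab(1) leaf])
  then obtain M where M: "M \<in> matchings E" "\<Union>M = V"
    using SRSI_even_perfect_matching[OF G S] by blast
  have "{x, b} \<in> M" if x: "x \<in> V" "\<And>y. {x, y} \<in> E \<Longrightarrow> y = b" for x
  proof -
    obtain e where e: "e \<in> M" "x \<in> e" using M(2) x(1) by blast
    hence "e \<in> E" using M by (auto simp: matchings_def)
    obtain y where "e = {x, y}" by (rule simple_graph_edge_other_end[OF G \<open>e \<in> E\<close> e(2)])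
    thus ?thesis using x(2)[of y] e \<open>e \<in> E\<close> by simp
  qed
  hence "{a, b} \<in> M" "{a', b} \<in> M" using V leaf leaf' by auto
  moreover have "{a, b} \<inter> {a', b} \<noteq> {}" by blast
  moreover have "disjoint M" using M(1) by (simp add: matchings_def)
  ultimately have "{a, b} = {a', b}" by (metis disjointD)
  thus ?thesis using V by (auto simp: doubleton_eq_iff)
qed

text \<open>Pins down the vertex set in the classification: a walk cannot leave a set that is closed
  under adjacency.\<close>

lemma graph_connected_closed:
  assumes "graph_connected V E" "U \<subseteq> V" "U \<noteq> {}"
    and closed: "\<And>x y. x \<in> U \<Longrightarrow> {x, y} \<in> E \<Longrightarrow> y \<in> U"
  shows "U = V"
proof -
  obtain u where u: "u \<in> U" using assms(3) by blast
  have "y \<in> U" if "y \<in> V" for y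
  proof -
    have "(u, y) \<in> {(x, y). {x, y} \<in> E}\<^sup>*"
      using assms(1,2) u that by (auto simp: graph_connected_def)
    thus ?thesis by (induction rule: rtrancl_induct) (use u closed in auto)
  qed
  thus ?thesis using assms(2) by blast
qed

text \<open>Another neighbour \<open>x\<close> of \<open>a\<close> would close a triangle with
  \<open>c\<close>, close a 4-cycle with \<open>d\<close>, or give the path
  \<open>x, a, b, c, d\<close> with middle vertex \<open>b\<close>.\<close>

lemma end_of_path4_leaf:
  assumes G: "simple_graph V E" and ac: "\<nexists>c. is_cycle E c" and S: "SRSI V E"
    and d: "distinct [a, b, c, d]"
    and e: "{a, b} \<in> E" "{b, c} \<in> E" "{c, d} \<in> E" and x: "{a, x} \<in> E"
  shows "x = b"
proof (rule ccontr)
  assume "x \<noteq> b"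
  have "x \<noteq> a" using G x by (auto simp: simple_graph_def)
  moreover have "x \<noteq> c"
    using ac is_cycleI[of E "[a, b, c]"] d e x by (auto simp: insert_commute)
  moreover have "x \<noteq> d"
    using ac is_cycleI[of E "[a, b, c, d]"] d e x by (auto simp: insert_commute)
  ultimately show False
    using SRSI_acyclic_no_path5[OF G ac S, of x a b c d] d e x \<open>x \<noteq> b\<close>
    by (auto simp: insert_commute)
qed

text \<open>Split on whether there is a path on four vertices. If so, that path is the whole tree.
  If not, there is not even a path on three vertices, so a single edge remains.\<close>

lemma SRSI_tree_imp:
  assumes T: "is_tree V E" and S: "SRSI V E"
  shows "(\<exists>a b. distinct [a, b] \<and> V = {a, b} \<and> E = {{a, b}}) \<or>
    (\<exists>a b c d. distinct [a, b, c, d] \<and> V = {a, b, c, d} \<and> E = {{a, b}, {b, c}, {c, d}})"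
proof -
  have G: "simple_graph V E" and C: "graph_connected V E" and ac: "\<nexists>c. is_cycle E c"
    using T by (auto simp: is_tree_def)
  have ne: "x \<noteq> y" if "{x, y} \<in> E" for x y
    using that G by (auto simp: simple_graph_def)
  have inV: "x \<in> V" "y \<in> V" if "{x, y} \<in> E" for x y
    using that G by (auto simp: simple_graph_def)
  have edge: "\<exists>x y. e = {x, y}" if "e \<in> E" for e
    using that G unfolding simple_graph_def by (metis card_2_iff)
  note sym = insert_commute
  show ?thesis
  proof (cases "\<exists>a b c d. distinct [a, b, c, d] \<and> {a, b} \<in> E \<and> {b, c} \<in> E \<and> {c, d} \<in> E")
    case True
    then obtain a b c d where d: "distinct [a, b, c, d]"
      and e: "{a, b} \<in> E" "{b, c} \<in> E" "{c, d} \<in> E" by blast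
    have e': "{d, c} \<in> E" "{c, b} \<in> E" "{b, a} \<in> E" using e by (auto simp: sym)
    have a: "x = b" if "{a, x} \<in> E" for x
      by (rule end_of_path4_leaf[OF G ac S d e that])
    have d': "x = c" if "{d, x} \<in> E" for x
      using d by (intro end_of_path4_leaf[OF G ac S _ e' that]) auto
    \<comment> \<open>A third neighbour \<open>x\<close> of \<open>b\<close> starts the path
      \<open>x, b, c, d\<close>, so it is a second leaf at \<open>b\<close> besides
      \<open>a\<close>.\<close>
    have b: "x = a \<or> x = c" if x: "{b, x} \<in> E" for x
    proof (rule ccontr)
      assume not: "\<not> ?thesis"
      moreover from this have "x \<noteq> d" using d'[of b] x d by (auto simp: sym)
      ultimately have dx: "distinct [x, b, c, d]" using d ne[OF x] by auto
      have xb: "{x, b} \<in> E" using x by (simp add: sym)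
      have "a = x"
        by (rule SRSI_leaf_unique[OF G S e(1) xb a end_of_path4_leaf[OF G ac S dx xb e(2,3)]])
      thus False using not by simp
    qed
    have c: "x = b \<or> x = d" if x: "{c, x} \<in> E" for x
    proof (rule ccontr)
      assume not: "\<not> ?thesis"
      moreover from this have "x \<noteq> a" using a[of c] x d by (auto simp: sym)
      ultimately have dx: "distinct [x, c, b, a]" using d ne[OF x] by auto
      have xc: "{x, c} \<in> E" using x by (simp add: sym)
      have "d = x"
        by (rule SRSI_leaf_unique[OF G S e'(1) xc d' end_of_path4_leaf[OF G ac S dx xc e'(2,3)]])
      thus False using not by simp
    qed
    have V: "{a, b, c, d} = V"
      using inV[OF e(1)] inV[OF e(3)] a b c d'
      by (intro graph_connected_closed[OF C]) auto
    have "E = {{a, b}, {b, c}, {c, d}}"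
    proof (intro equalityI subsetI)
      fix f assume f: "f \<in> E"
      then obtain x y where xy: "f = {x, y}" using edge by blast
      hence "x \<in> {a, b, c, d}" using inV f V by blast
      thus "f \<in> {{a, b}, {b, c}, {c, d}}"
        using a[of y] b[of y] c[of y] d'[of y] f xy by (auto simp: sym)
    qed (use e in auto)
    thus ?thesis using d V by blast
  next
    case no4: False
    have "2 \<le> card V" using S by (simp add: SRSI_def)
    then obtain u v where uv: "u \<in> V" "v \<in> V" "u \<noteq> v"
      by (metis card_le_Suc0_iff_eq card.infinite not_numeral_le_zero numeral_2_eq_2 not_less_eq_eq)
    \<comment> \<open>Without edges the proper subset \<open>{u}\<close> would be closed under
      adjacency.\<close>
    have "\<exists>a b. {a, b} \<in> E"
      using graph_connected_closed[OF C, of "{u}"] uv by blast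
    then obtain a b where ab: "{a, b} \<in> E" by blast
    \<comment> \<open>With neither triangles nor paths on four vertices, both ends of a path
      \<open>x, y, z\<close> are leaves at \<open>y\<close>, which contradicts uniqueness of
      leaves.\<close>
    have no3: "x = z" if xyz: "{x, y} \<in> E" "{y, z} \<in> E" for x y z
    proof (rule ccontr)
      assume xz: "x \<noteq> z"
      have leaf: "x' = y" if xyz: "{x, y} \<in> E" "{y, z} \<in> E" "x \<noteq> z" and x': "{x, x'} \<in> E" for x z x'
      proof (rule ccontr)
        assume "x' \<noteq> y"
        moreover have "x' \<noteq> z"
          using ac is_cycleI[of E "[x, y, z]"] xyz x' ne[OF xyz(1)] ne[OF xyz(2)]
          by (auto simp: sym)
        ultimately have "distinct [x', x, y, z]"
          using xyz ne[OF xyz(1)] ne[OF xyz(2)] ne[OF x'] by auto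
        moreover have "{x', x} \<in> E" using x' by (simp add: sym)
        ultimately show False using no4 xyz by blast
      qed
      have zyx: "{z, y} \<in> E" "{y, x} \<in> E" using xyz by (auto simp: sym)
      show False
        using SRSI_leaf_unique[OF G S xyz(1) zyx(1) leaf[OF xyz xz] leaf[OF zyx]] xz by blast
    qed
    have a: "x = b" if "{a, x} \<in> E" for x
      using no3[of x a b] ab that by (simp add: sym)
    have b: "x = a" if "{b, x} \<in> E" for x
      using no3[of x b a] ab that by (simp add: sym)
    have V: "{a, b} = V"
      using inV[OF ab] a b by (intro graph_connected_closed[OF C]) auto
    have "E = {{a, b}}"
    proof (intro equalityI subsetI)
      fix f assume f: "f \<in> E"
      then obtain x y where xy: "f = {x, y}" using edge by blast
      hence "x \<in> {a, b}" using inV f V by blast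
      thus "f \<in> {{a, b}}" using a[of y] b[of y] f xy by (auto simp: sym)
    qed (use ab in auto)
    thus ?thesis using ne[OF ab] V by auto
  qed
qed

subsection \<open>The paths on two and four vertices\<close>

lemma strict_mono_on_nth:
  assumes "sorted_wrt (<) xs"
  shows "strict_mono_on {1..length xs} (\<lambda>i. xs ! (i - 1))"
  using assms by (auto simp: strict_mono_on_def sorted_wrt_iff_nth_less)

lemma prod_linear_nonzero: "(\<Prod>x\<leftarrow>xs. [:- x, 1:]) \<noteq> (0 :: real poly)"
  by (auto simp: prod_list_zero_iff)

lemma order_prod_linear:
  fixes a :: real
  assumes "distinct xs" "a \<in> set xs"
  shows "order a (\<Prod>x\<leftarrow>xs. [:- x, 1:]) = 1"
  using assms
proof (induction xs)
  case (Cons y ys)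
  have 1: "order a [:- y, 1:] = (if a = y then 1 else 0)"
    using order_power_n_n[of y 1] by (auto simp: order_0I)
  have 2: "order a (\<Prod>x\<leftarrow>ys. [:- x, 1:]) = 0" if "a \<notin> set ys"
    using that by (intro order_0I) (induction ys, auto)
  have "order a (\<Prod>x\<leftarrow>y # ys. [:- x, 1:]) = order a [:- y, 1:] + order a (\<Prod>x\<leftarrow>ys. [:- x, 1:])"
    using prod_linear_nonzero[of "y # ys"] by (simp add: order_mult del: mult_pCons_left)
  thus ?case using Cons 1 2 by auto
qed simp

lemma simple_roots_prod_linear:
  assumes "sorted_wrt (<) xs"
  shows "simple_roots (\<Prod>x\<leftarrow>xs. [:- x, 1:]) (length xs) (\<lambda>i. xs ! (i - 1))"
proof -
  have "distinct xs" using assms by (simp add: strict_sorted_iff)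
  moreover have "{x. poly (\<Prod>x\<leftarrow>xs. [:- x, 1:]) x = 0} = set xs"
    by (induction xs) auto
  moreover have "(\<lambda>i. xs ! (i - 1)) ` {1..length xs} = set xs"
  proof -
    have "{1..length xs} = Suc ` {..<length xs}" by (simp add: image_Suc_lessThan)
    thus ?thesis by (auto simp: set_conv_nth image_image)
  qed
  ultimately show ?thesis
    using strict_mono_on_nth[OF assms] unfolding simple_roots_def
    by (auto simp: order_prod_linear)
qed

text \<open>Reduces the property to explicit sorted lists of roots: factoring into distinct linear
  factors gives simplicity. Lists count from 0 and the roots in \<open>simple_roots\<close> from 1,
  hence the shift \<open>i - 1\<close>.\<close>

lemma SRSI_atI:
  assumes "2 \<le> card V" "v \<in> V" "length xs = card V" "length ys = card V - 1"
    and "sorted_wrt (<) xs" "sorted_wrt (<) ys"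
    and "matching_poly V E w = (\<Prod>x\<leftarrow>xs. [:- x, 1:])"
    and "matching_poly (V - {v}) (del_vertex E v) w = (\<Prod>x\<leftarrow>ys. [:- x, 1:])"
    and "\<And>i. i < length ys \<Longrightarrow> xs ! i < ys ! i \<and> ys ! i < xs ! Suc i"
  shows "SRSI_at V E w v"
  unfolding SRSI_at_def
proof (intro conjI exI)
  show "simple_roots (matching_poly V E w) (card V) (\<lambda>i. xs ! (i - 1))"
    using simple_roots_prod_linear[OF assms(5)] assms by simp
  show "simple_roots (matching_poly (V - {v}) (del_vertex E v) w) (card V - 1) (\<lambda>i. ys ! (i - 1))"
    using simple_roots_prod_linear[OF assms(6)] assms by simp
  show "\<forall>i\<in>{1..card V - 1}. xs ! (i - 1) < ys ! (i - 1) \<and> ys ! (i - 1) < xs ! (Suc i - 1)"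
  proof
    fix i assume "i \<in> {1..card V - 1}"
    thus "xs ! (i - 1) < ys ! (i - 1) \<and> ys ! (i - 1) < xs ! (Suc i - 1)"
      using assms(9)[of "i - 1"] assms(4) by (auto simp: Suc_diff_Suc)
  qed
qed (use assms in auto)

section \<open>Enumerating the matchings of short paths\<close>

lemma matchings_singleton: "matchings {e} = {{}, {e}}"
  by (auto simp: matchings_def subset_singleton_iff)

text \<open>A matching either omits \<open>e\<close> or adds \<open>e\<close> to a matching disjoint
  from it. The guard \<open>f \<noteq> e\<close> takes care of an \<open>e\<close> that already lies
  in \<open>E\<close>.\<close>

lemma matchings_insert:
  "matchings (insert e E) = matchings E \<union> insert e ` {M \<in> matchings E. \<forall>f\<in>M. f \<noteq> e \<longrightarrow> disjnt e f}"
proof (intro equalityI subsetI)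
  fix M assume M: "M \<in> matchings (insert e E)"
  show "M \<in> matchings E \<union> insert e ` {M \<in> matchings E. \<forall>f\<in>M. f \<noteq> e \<longrightarrow> disjnt e f}"
  proof (cases "e \<in> M")
    case True
    hence "M = insert e (M - {e})" by auto
    moreover have "M - {e} \<in> {M \<in> matchings E. \<forall>f\<in>M. f \<noteq> e \<longrightarrow> disjnt e f}"
      using M True by (auto simp: matchings_def pairwise_def)
    ultimately show ?thesis by blast
  qed (use M in \<open>auto simp: matchings_def\<close>)
qed (auto simp: matchings_def pairwise_insert disjnt_sym)

lemma matchings_path3_edges:
  assumes "\<not> disjnt e f" "e \<noteq> f"
  shows "matchings {e, f} = {{}, {e}, {f}}"
proof -
  have "{M \<in> {{}, {f}}. \<forall>g\<in>M. g \<noteq> e \<longrightarrow> disjnt e g} = {{}}" using assms by auto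
  thus ?thesis by (subst matchings_insert) (auto simp: matchings_singleton)
qed

lemma matchings_path4_edges:
  assumes "\<not> disjnt e f" "\<not> disjnt f g" "disjnt e g" "e \<noteq> f" "f \<noteq> g"
  shows "matchings {e, f, g} = {{}, {e}, {f}, {g}, {e, g}}"
proof -
  have "{M \<in> {{}, {f}, {g}}. \<forall>h\<in>M. h \<noteq> e \<longrightarrow> disjnt e h} = {{}, {g}}" using assms by auto
  thus ?thesis
    using assms by (subst matchings_insert) (auto simp: matchings_path3_edges)
qed

text \<open>The polynomial is x^2 - w with roots plus and minus sqrt w, and the single remaining
  vertex contributes the root 0 between them.\<close>

lemma SRSI_P2:
  assumes d: "distinct [a, b]" and V: "V = {a, b}" and E: "E = {{a, b}}"
  shows "SRSI V E"
proof -
  have G: "simple_graph V E" using d by (auto simp: simple_graph_def V E)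
  have card: "card V = 2" using d by (simp add: V)
  have "SRSI_at V E w v" if w: "weight_function E w" and v: "v \<in> V" for w v
  proof -
    define s where "s = sqrt (w {a, b})"
    have s: "0 < s" "s * s = w {a, b}" using w by (auto simp: s_def E weight_function_def)
    have del: "del_vertex E v = {}" using v by (auto simp: V E del_vertex_def)
    have G': "simple_graph (V - {v}) {}" by (simp add: simple_graph_def V)
    have card': "card (V - {v}) = 1" using v card by simp
    have me: "matchings ({} :: 'a set set) = {{}}" by (auto simp: matchings_def)
    show ?thesis
    proof (rule SRSI_atI[where xs = "[-s, s]" and ys = "[0]"])
      show "matching_poly V E w = (\<Prod>x\<leftarrow>[-s, s]. [:- x, 1:])"
        unfolding poly_eq_poly_eq_iff[symmetric] fun_eq_iff poly_matching_poly[OF G] card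
        by (simp add: E matchings_singleton algebra_simps power2_eq_square flip: s(2))
      show "matching_poly (V - {v}) (del_vertex E v) w = (\<Prod>x\<leftarrow>[0]. [:- x, 1:])"
        unfolding poly_eq_poly_eq_iff[symmetric] fun_eq_iff del poly_matching_poly[OF G'] card'
        by (simp add: me)
    qed (use v card s in auto)
  qed
  thus ?thesis using card by (simp add: SRSI_def)
qed

text \<open>The squares of \<open>x\<close> and \<open>y\<close> are the roots of T^2 - S T + P. A
  negative value at \<open>t\<close> makes the discriminant positive, and the signs of
  \<open>S\<close> and \<open>P\<close> make both roots positive.\<close>

lemma real_quadratic_roots:
  fixes S P t :: real
  assumes "0 < S" "0 < P" "0 < t" "t\<^sup>2 - S * t + P < 0"
  shows "\<exists>x y. 0 < x \<and> x < y \<and> x\<^sup>2 + y\<^sup>2 = S \<and> x\<^sup>2 * y\<^sup>2 = P"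
proof -
  have "S\<^sup>2 - 4 * P = (2 * t - S)\<^sup>2 + 4 * - (t\<^sup>2 - S * t + P)"
    by (simp add: power2_eq_square algebra_simps)
  also have "\<dots> > 0" using assms(4) by (intro add_nonneg_pos) simp_all
  finally have D: "0 < S\<^sup>2 - 4 * P" .
  define r where "r = sqrt (S\<^sup>2 - 4 * P)"
  have r: "0 < r" "r\<^sup>2 = S\<^sup>2 - 4 * P" using D by (simp_all add: r_def)
  hence "r\<^sup>2 < S\<^sup>2" using assms by simp
  hence "r < S" using assms(1) by (simp add: power_less_imp_less_base)
  hence "0 < sqrt ((S - r) / 2)" "sqrt ((S - r) / 2) < sqrt ((S + r) / 2)"
    "(sqrt ((S - r) / 2))\<^sup>2 = (S - r) / 2" "(sqrt ((S + r) / 2))\<^sup>2 = (S + r) / 2"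
    using r(1) by simp_all
  moreover have "(S - r) / 2 * ((S + r) / 2) = P"
    using r(2) by (simp add: power2_eq_square algebra_simps)
  moreover have "(S - r) / 2 + (S + r) / 2 = S" by (simp add: field_simps)
  ultimately show ?thesis by metis
qed

lemma root_between:
  fixes x y t :: real
  assumes "0 < x" "x < y" "0 < t" "(t\<^sup>2 - x\<^sup>2) * (t\<^sup>2 - y\<^sup>2) < 0"
  shows "x < t" "t < y"
proof -
  have "x\<^sup>2 < y\<^sup>2" using assms by (intro power_strict_mono) auto
  hence "x\<^sup>2 < t\<^sup>2" "t\<^sup>2 < y\<^sup>2" using assms(4) by (auto simp: mult_less_0_iff)
  thus "x < t" "t < y" using assms by (auto intro: power_less_imp_less_base)
qed

text \<open>The polynomial z^4 - S z^2 + p r is even, with roots \<open>-y, -x, x, y\<close>.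
  Deleting \<open>a\<close> or \<open>b\<close> leaves z^3 - t^2 z with t^2 = q + r or t^2 = r, so
  everything reduces to the sign of T^2 - S T + p r at T = t^2.\<close>

lemma SRSI_at_P4:
  assumes d: "distinct [a, b, c, d]" and V: "V = {a, b, c, d}" and E: "E = {{a, b}, {b, c}, {c, d}}"
    and w: "weight_function E w"
  shows "SRSI_at V E w a" "SRSI_at V E w b"
proof -
  define p q r where "p = w {a, b}" and "q = w {b, c}" and "r = w {c, d}"
  have pos: "0 < p" "0 < q" "0 < r" using w by (auto simp: p_def q_def r_def E weight_function_def)
  have G: "simple_graph V E" using d by (auto simp: simple_graph_def V E)
  have card: "card V = 4" using d by (simp add: V)
  have ab: "a \<in> V" "b \<in> V" by (simp_all add: V)
  have ne: "{a, b} \<noteq> {b, c}" "{b, c} \<noteq> {c, d}" "{a, b} \<noteq> {c, d}"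
    using d by (auto simp: doubleton_eq_iff)
  have dj: "\<not> disjnt {a, b} {b, c}" "\<not> disjnt {b, c} {c, d}" "disjnt {a, b} {c, d}"
    using d by (auto simp: disjnt_def)
  define S where "S = p + q + r"
  \<comment> \<open>The two values are -(p q) and -(q r).\<close>
  have neg1: "(q + r)\<^sup>2 - S * (q + r) + p * r < 0"
    using pos by (simp add: S_def power2_eq_square algebra_simps)
  have neg2: "r\<^sup>2 - S * r + p * r < 0"
    using pos by (simp add: S_def power2_eq_square algebra_simps)
  obtain x y where xy: "0 < x" "x < y" "x\<^sup>2 + y\<^sup>2 = S" "x\<^sup>2 * y\<^sup>2 = p * r"
    using real_quadratic_roots[of S "p * r" r] neg2 pos by (auto simp: S_def)
  have factor: "t\<^sup>2 - S * t + p * r = (t - x\<^sup>2) * (t - y\<^sup>2)" for t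
    by (simp add: power2_eq_square algebra_simps flip: xy(3,4))
  have mp: "matching_poly V E w = (\<Prod>u\<leftarrow>[-y, -x, x, y]. [:- u, 1:])"
  proof -
    have "poly (matching_poly V E w) z = poly (\<Prod>u\<leftarrow>[-y, -x, x, y]. [:- u, 1:]) z" for z
    proof -
      have "poly (matching_poly V E w) z = (z\<^sup>2)\<^sup>2 - S * z\<^sup>2 + p * r"
        using ne d unfolding poly_matching_poly[OF G] card unfolding E matchings_path4_edges[OF dj ne(1,2)]
        by (simp add: S_def algebra_simps flip: p_def q_def r_def)
      also have "\<dots> = poly (\<Prod>u\<leftarrow>[-y, -x, x, y]. [:- u, 1:]) z"
        unfolding factor by (simp add: power2_eq_square algebra_simps)
      finally show ?thesis .
    qed
    thus ?thesis by (simp flip: poly_eq_poly_eq_iff add: fun_eq_iff)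
  qed
  \<comment> \<open>By symmetry about 0, interlacing of \<open>-y, -x, x, y\<close> with
    \<open>-t, 0, t\<close> amounts to x < t < y.\<close>
  have interlace: "SRSI_at V E w v"
    if v: "v \<in> V" and t: "0 < t" "(t\<^sup>2)\<^sup>2 - S * t\<^sup>2 + p * r < 0"
      and mpv: "\<And>z. poly (matching_poly (V - {v}) (del_vertex E v) w) z = z ^ 3 - t\<^sup>2 * z" for v t
  proof (rule SRSI_atI[where xs = "[-y, -x, x, y]" and ys = "[-t, 0, t]"])
    show "matching_poly (V - {v}) (del_vertex E v) w = (\<Prod>u\<leftarrow>[-t, 0, t]. [:- u, 1:])"
      unfolding poly_eq_poly_eq_iff[symmetric] fun_eq_iff mpv
      by (simp add: power2_eq_square power3_eq_cube algebra_simps)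
    have "x < t" "t < y" using root_between[OF xy(1,2) t(1)] t(2) unfolding factor by auto
    thus "[-y, -x, x, y] ! i < [-t, 0, t] ! i \<and> [-t, 0, t] ! i < [-y, -x, x, y] ! Suc i"
      if "i < length [-t, 0, t]" for i
      using that xy(1) by (auto simp: less_Suc_eq)
  qed (use v card xy t mp in auto)
  show "SRSI_at V E w a"
  proof (rule interlace[where t = "sqrt (q + r)"])
    have "del_vertex E a = {{b, c}, {c, d}}" using d by (auto simp: del_vertex_def E)
    moreover have "card (V - {a}) = 3" using ab by (simp add: card)
    ultimately show "poly (matching_poly (V - {a}) (del_vertex E a) w) z = z ^ 3 - (sqrt (q + r))\<^sup>2 * z" for z
      using ne pos simple_graph_del_vertex[OF G, of a]
      by (simp add: poly_matching_poly matchings_path3_edges[OF dj(2) ne(2)] algebra_simps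
          flip: q_def r_def)
  qed (use neg1 pos in \<open>simp_all add: V\<close>)
  show "SRSI_at V E w b"
  proof (rule interlace[where t = "sqrt r"])
    have "del_vertex E b = {{c, d}}" using d by (auto simp: del_vertex_def E)
    moreover have "card (V - {b}) = 3" using ab by (simp add: card)
    ultimately show "poly (matching_poly (V - {b}) (del_vertex E b) w) z = z ^ 3 - (sqrt r)\<^sup>2 * z" for z
      using ne pos simple_graph_del_vertex[OF G, of b]
      by (simp add: poly_matching_poly matchings_singleton flip: r_def)
  qed (use neg2 pos in \<open>simp_all add: V\<close>)
qed

text \<open>Reading the path backwards turns \<open>d\<close> and \<open>c\<close> into the cases of
  \<open>a\<close> and \<open>b\<close>.\<close>

lemma SRSI_P4:
  assumes d: "distinct [a, b, c, d]" and V: "V = {a, b, c, d}" and E: "E = {{a, b}, {b, c}, {c, d}}"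
  shows "SRSI V E"
proof -
  have d': "distinct [d, c, b, a]" using d by auto
  have V': "V = {d, c, b, a}" using V by auto
  have E': "E = {{d, c}, {c, b}, {b, a}}" using E by (auto simp: insert_commute)
  show ?thesis
    using SRSI_at_P4[OF d V E] SRSI_at_P4[OF d' V' E'] d
    unfolding SRSI_def by (auto simp: V)
qed

section \<open>Isomorphism with the paths\<close>

lemma path_graph_2: "path_verts 2 = {0, 1}" "path_edges 2 = {{0, 1}}"
  by (auto simp: path_verts_def path_edges_def)

lemma path_graph_4: "path_verts 4 = {0, 1, 2, 3}" "path_edges 4 = {{0, 1}, {1, 2}, {2, 3}}"
proof -
  show "path_verts 4 = {0, 1, 2, 3}" by (auto simp: path_verts_def)
  have "Suc i < 4 \<longleftrightarrow> i = 0 \<or> i = 1 \<or> i = 2" for i by auto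
  thus "path_edges 4 = {{0, 1}, {1, 2}, {2, 3}}"
    by (auto simp: path_edges_def numeral_2_eq_2 numeral_3_eq_3)
qed

text \<open>Edges of both graphs are pairs of vertices, so the condition on pairs determines
  \<open>E\<close> completely: it is the edge set of the target pulled back along the inverse
  bijection.\<close>

lemma graph_iso_imp_edges:
  assumes G: "simple_graph V E" and f: "bij_betw f V V'"
    and iso: "\<forall>u\<in>V. \<forall>v\<in>V. {u, v} \<in> E \<longleftrightarrow> {f u, f v} \<in> E'"
    and G': "simple_graph V' E'"
  shows "E = (`) (inv_into V f) ` E'"
proof (intro equalityI subsetI)
  let ?g = "inv_into V f"
  have gf: "?g (f x) = x" if "x \<in> V" for x using f that by (simp add: bij_betw_inv_into_left)
  fix e assume e: "e \<in> E"
  then obtain x y where xy: "e = {x, y}" "x \<in> V" "y \<in> V"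
    using G unfolding simple_graph_def by (metis card_2_iff insert_subset)
  hence "{f x, f y} \<in> E'" using iso e by blast
  moreover have "?g ` {f x, f y} = e" using xy gf by simp
  ultimately show "e \<in> (`) ?g ` E'" by blast
next
  let ?g = "inv_into V f"
  have fg: "f (?g x) = x" "?g x \<in> V" if "x \<in> V'" for x
    using f that by (auto simp: bij_betw_inv_into_right bij_betw_def inv_into_into)
  fix e assume "e \<in> (`) ?g ` E'"
  then obtain e' where e': "e' \<in> E'" "e = ?g ` e'" by blast
  then obtain x y where xy: "e' = {x, y}" "x \<in> V'" "y \<in> V'"
    using G' unfolding simple_graph_def by (metis card_2_iff insert_subset)
  thus "e \<in> E" using iso fg e' by auto
qed

lemma graph_iso_P2_iff:
  assumes G: "simple_graph V E"
  shows "graph_iso V E (path_verts 2) (path_edges 2) \<longleftrightarrow>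
    (\<exists>a b. distinct [a, b] \<and> V = {a, b} \<and> E = {{a, b}})" (is "?L \<longleftrightarrow> ?R")
proof
  assume ?L
  then obtain f where f: "bij_betw f V {0::nat, 1}"
    "\<forall>u\<in>V. \<forall>v\<in>V. {u, v} \<in> E \<longleftrightarrow> {f u, f v} \<in> {{0, 1}}"
    unfolding graph_iso_def path_graph_2 by blast
  let ?g = "inv_into V f"
  have g: "bij_betw ?g {0, 1} V" using f(1) by (rule bij_betw_inv_into)
  have "E = (`) ?g ` {{0, 1}}"
    by (rule graph_iso_imp_edges[OF G f]) (auto simp: simple_graph_def)
  thus ?R using g
    by (intro exI[of _ "?g 0"] exI[of _ "?g 1"]) (auto simp: bij_betw_def inj_on_def)
next
  assume ?R
  then obtain a b where "distinct [a, b]" "V = {a, b}" "E = {{a, b}}" by blast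
  thus ?L unfolding graph_iso_def path_graph_2
    by (intro exI[of _ "\<lambda>x. if x = a then 0 else 1"])
      (auto simp: bij_betw_def inj_on_def doubleton_eq_iff)
qed

lemma graph_iso_P4_iff:
  assumes G: "simple_graph V E"
  shows "graph_iso V E (path_verts 4) (path_edges 4) \<longleftrightarrow>
    (\<exists>a b c d. distinct [a, b, c, d] \<and> V = {a, b, c, d} \<and> E = {{a, b}, {b, c}, {c, d}})"
    (is "?L \<longleftrightarrow> ?R")
proof
  assume ?L
  then obtain f where f: "bij_betw f V {0::nat, 1, 2, 3}"
    "\<forall>u\<in>V. \<forall>v\<in>V. {u, v} \<in> E \<longleftrightarrow> {f u, f v} \<in> {{0, 1}, {1, 2}, {2, 3}}"
    unfolding graph_iso_def path_graph_4 by blast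
  let ?g = "inv_into V f"
  have g: "bij_betw ?g {0, 1, 2, 3} V" using f(1) by (rule bij_betw_inv_into)
  have "E = (`) ?g ` {{0, 1}, {1, 2}, {2, 3}}"
    by (rule graph_iso_imp_edges[OF G f]) (auto simp: simple_graph_def)
  moreover have "distinct (map ?g [0, 1, 2, 3])"
    unfolding distinct_map using g by (simp add: bij_betw_def)
  moreover have "V = ?g ` {0, 1, 2, 3}" using g by (simp add: bij_betw_def)
  ultimately show ?R
    by (intro exI[of _ "?g 0"] exI[of _ "?g 1"] exI[of _ "?g 2"] exI[of _ "?g 3"]) simp
next
  assume ?R
  then obtain a b c d where "distinct [a, b, c, d]" "V = {a, b, c, d}" "E = {{a, b}, {b, c}, {c, d}}"
    by blast
  thus ?L unfolding graph_iso_def path_graph_4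
    \<comment> \<open>Each vertex goes to its position on the path; the default value 3 serves
      \<open>d\<close>.\<close>
    by (intro exI[of _ "\<lambda>x. if x = a then 0 else if x = b then 1 else if x = c then 2 else 3"])
      (auto simp: bij_betw_def inj_on_def doubleton_eq_iff)
qed

theorem corollary3p18:
  fixes V :: "'a set" and E :: "'a set set"
  assumes "is_tree V E" and "card V \<ge> 2"
  shows "SRSI V E \<longleftrightarrow>
    graph_iso V E (path_verts 2) (path_edges 2) \<or> graph_iso V E (path_verts 4) (path_edges 4)"
proof -
  have G: "simple_graph V E" using assms(1) by (simp add: is_tree_def)
  show ?thesis
    unfolding graph_iso_P2_iff[OF G] graph_iso_P4_iff[OF G]
    using SRSI_tree_imp[OF assms(1)] SRSI_P2 SRSI_P4 by metis
qed

end
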